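(* Let $\eta$ be a positive real-valued function defined for $x\ge 2$, and let $\alpha\in(0,1)$. Let $\mathcal{A}=\{a_n\}_{n=1}^{\infty}$ be a strictly increasing sequence of positive integers ($a_n<a_{n+1}$ for all $n$), and let $\mathcal{B}=\{b_n\}_{n=1}^{\infty}$ be a sequence of positive integers, not necessarily distinct, such that $\mathrm{ord}_{\mathcal{B}}(v)=\#\{j\in\mathbb{N}: b_j=v\}<\infty$ for every $v\in\mathbb{N}$. Suppose there are constants $K_1,\dots,K_6>0$ such that for all real $x\ge 2$: (i) $K_1\,x/\eta(x)\le \mathcal{A}(x)\le K_2\, x/\eta(x)$ and $\mathcal{A}(x/2)\ge K_3\,\mathcal{A}(x)$; (ii) $\mathcal{A}(x,r)\le K_4\,\frac{r}{\varphi(r)}\,\frac{x}{\eta(x)^2}$ for every positive integer $r$; (iii) $\mathcal{B}(x/2)\ge K_5\,\mathcal{B}(x)$; (iv) $\displaystyle\sum_{\substack{j\in\mathbb{N}:\ b_j\le x}}\ \sum_{p\le(\log x)^{\alpha}}\frac{\lambda_{\mathcal{B}}(x;j,p)\log p}{p}\le K_6\,\mathcal{B}(x)^2$, where $\lambda_{\mathcal{B}}(x;j,p)=\#\{k\in\mathbb{N}: b_k\le x,\ b_k\equiv b_j \pmod p\}$. Let $r(n)=\#\{(i,j)\in\mathbb{N}^2: a_i+b_j=n\}$ and $\rho_{\mathcal{B}}(x)=\max_{1\le v\le x}\mathrm{ord}_{\mathcal{B}}(v)$. Then there exist positive constants $c_1,c_2$ depending only on $\alpha$ and $K_1,\dots,K_6$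 such that for all $x\ge 2$, \[ \#\Big\{n\le x:\ r(n)\ge c_1\frac{\mathcal{B}(x)}{\eta(x)}\Big\}\ \ge\ c_2\, x\,\frac{\mathcal{B}(x)}{\mathcal{B}(x)+\rho_{\mathcal{B}}(x)\eta(x)}. \]
   Context: For a sequence $\mathcal{C}=\{c_n\}$ of positive integers (not necessarily distinct), $\mathcal{C}(x)=\#\{n\in\mathbb{N}: c_n\le x\}$ (counted with multiplicity) and $\mathcal{C}(x,r)=\#\{n\in\mathbb{N}: c_n\le x \text{ and } c_n+r\in\mathcal{C}\}$. $\varphi$ is Euler's totient function; $p$ denotes primes. The paper states the hypotheses with the symbols $\ll,\gg,\asymp$ without specifying the range of $x$; here they are written with explicit constants for $x\ge 2$. *)

theory Defs
  imports Complex_Main "HOL-Number_Theory.Number_Theory"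
begin

text \<open>
  A sequence \<open>c\<^sub>1, c\<^sub>2, \<dots>\<close> of natural numbers is a function \<^typ>\<open>nat \<Rightarrow> nat\<close>; the indices
  are relabelled to start at 0, which changes none of the counts below.
  All counts are by index, i.e. with multiplicity.  They are cardinalities of finite sets
  (rather than the junk value 0) as soon as \<open>c\<close> takes every value only finitely often.
\<close>

definition count_le :: "(nat \<Rightarrow> nat) \<Rightarrow> real \<Rightarrow> nat" where
  "count_le c x = card {n. real (c n) \<le> x}"

definition count_shift :: "(nat \<Rightarrow> nat) \<Rightarrow> real \<Rightarrow> nat \<Rightarrow> nat" where
  "count_shift c x r = card {n. real (c n) \<le> x \<and> c n + r \<in> range c}"

definition ord_seq :: "(nat \<Rightarrow> nat) \<Rightarrow> nat \<Rightarrow> nat" where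
  "ord_seq b v = card {j. b j = v}"

definition rho :: "(nat \<Rightarrow> nat) \<Rightarrow> real \<Rightarrow> nat" where
  "rho b x = Max (ord_seq b ` {v. 1 \<le> v \<and> real v \<le> x})"

definition lambda_cong :: "(nat \<Rightarrow> nat) \<Rightarrow> real \<Rightarrow> nat \<Rightarrow> nat \<Rightarrow> nat" where
  "lambda_cong b x j p = card {k. real (b k) \<le> x \<and> [b k = b j] (mod p)}"

definition rep_count :: "(nat \<Rightarrow> nat) \<Rightarrow> (nat \<Rightarrow> nat) \<Rightarrow> nat \<Rightarrow> nat" where
  "rep_count a b n = card {(i, j). a i + b j = n}"

end

theory Submission
  imports Defs "HOL-Analysis.Convex"
begin

text \<open>
  Let \<open>R n\<close> count the representations \<open>a\<^sub>i + b\<^sub>j = n\<close> with \<open>a\<^sub>i, b\<^sub>j \<le> x/2\<close>. The first moment of \<open>R\<close> is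
  \<open>\<A>(x/2) \<B>(x/2) \<ge> K1 K3 K5 x \<B>(x) / \<eta>(x)\<close>. The second moment counts solutions of
  \<open>a\<^sub>i + b\<^sub>j = a\<^sub>k + b\<^sub>l\<close>: those with \<open>b\<^sub>j = b\<^sub>l\<close> contribute at most \<open>\<A>(x) \<B>(x) \<rho>(x)\<close>, the others are
  controlled by the shift hypothesis with \<open>r = \<bar>b\<^sub>j - b\<^sub>l\<bar>\<close>. The Cauchy-Schwarz inequality on the set
  where \<open>R\<close> exceeds half of its mean bound then gives the claim. The arithmetic input is
  \<open>r / \<phi>(r) \<lless> 1 + (\<Sum>p dvd r, p \<le> (ln x) powr \<alpha>. ln p / p)\<close> for \<open>r \<le> x\<close>, which makes
  the sum of \<open>r / \<phi>(r)\<close> over all pairs accessible to the hypothesis on \<open>\<lambda>\<close>.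
\<close>

section \<open>Euler products over finite sets of primes\<close>

lemma sum_Pow_insert:
  fixes f :: "'a set \<Rightarrow> 'b::comm_monoid_add"
  assumes "finite A" "x \<notin> A"
  shows "(\<Sum>X\<in>Pow (insert x A). f X) = (\<Sum>X\<in>Pow A. f X) + (\<Sum>X\<in>Pow A. f (insert x X))"
proof -
  have "inj_on (insert x) (Pow A)"
    using assms(2) by (intro inj_onI) (metis PowD insert_ident subsetD)
  then have "(\<Sum>X\<in>insert x ` Pow A. f X) = (\<Sum>X\<in>Pow A. f (insert x X))"
    by (simp add: sum.reindex)
  moreover have "Pow A \<inter> insert x ` Pow A = {}"
    using assms(2) by auto
  ultimately show ?thesis
    using assms(1) by (simp add: Pow_insert sum.union_disjoint)
qed

lemma sum_Pow_inverse_prod: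
  fixes P :: "nat set"
  assumes "finite P"
  shows "(\<Sum>X\<in>Pow P. 1 / real (\<Prod>X)) = (\<Prod>p\<in>P. 1 + 1 / real p)"
  using prod_add[OF assms, of "\<lambda>p. 1 / real p" "\<lambda>_. 1"] assms
  by (simp add: prod_dividef add.commute)

text \<open>Splitting the logarithm of each product over its factors, p receives the weight ln p / p
  times the product of 1 + 1 / q over the other q in P; supplying the missing factor 1 + 1 / p,
  which is at least 1, gives the bound. The induction does this one p at a time. The condition
  \<open>0 \<notin> P\<close> keeps all products positive, so that \<open>ln\<close> is additive on
  them.\<close>

lemma sum_Pow_ln_prod_le:
  fixes P :: "nat set"
  assumes "finite P" "0 \<notin> P"
  shows "(\<Sum>X\<in>Pow P. ln (real (\<Prod>X)) / real (\<Prod>X))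
      \<le> (\<Sum>p\<in>P. ln (real p) / real p) * (\<Prod>p\<in>P. 1 + 1 / real p)"
  using assms
proof (induction P rule: finite_induct)
  case empty
  then show ?case by simp
next
  case (insert p P)
  define W where "W = (\<Prod>p\<in>P. 1 + 1 / real p)"
  define L where "L = (\<Sum>X\<in>Pow P. ln (real (\<Prod>X)) / real (\<Prod>X))"
  define S where "S = (\<Sum>p\<in>P. ln (real p) / real p)"
  have p: "p \<ge> 1" using insert.prems by (cases p) auto
  have LS: "L \<le> S * W" using insert unfolding W_def L_def S_def by simp
  have W0: "W \<ge> 0" unfolding W_def by (intro prod_nonneg) auto
  have t: "ln (real (\<Prod>(insert p X))) / real (\<Prod>(insert p X))
     = (1 / real p) * (ln (real (\<Prod>X)) / real (\<Prod>X)) + (ln (real p) / real p) * (1 / real (\<Prod>X))"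
    if "X \<in> Pow P" for X
  proof -
    have "finite X" "p \<notin> X" "0 \<notin> X" using that insert finite_subset by auto
    then have "real (\<Prod>X) > 0" by (simp add: prod_pos_nat_iff flip: of_nat_prod) (metis gr0I)
    moreover have "\<Prod>(insert p X) = p * \<Prod>X" using \<open>finite X\<close> \<open>p \<notin> X\<close> by simp
    ultimately show ?thesis
      using p by (simp add: ln_mult field_simps del: of_nat_prod)
  qed
  have "(\<Sum>X\<in>Pow (insert p P). ln (real (\<Prod>X)) / real (\<Prod>X))
     = L + ((1 / real p) * L + (ln (real p) / real p) * W)"
    unfolding sum_Pow_insert[OF insert.hyps] W_def L_def sum_Pow_inverse_prod[OF insert.hyps(1), symmetric]
      sum_distrib_left sum.distrib[symmetric]
    by (intro sum.cong refl arg_cong2[of _ _ _ _ "(+)"] t)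
  also have "\<dots> \<le> (1 + 1 / real p) * (S * W) + (ln (real p) / real p) * W * (1 + 1 / real p)"
  proof -
    have "(1 + 1 / real p) * L \<le> (1 + 1 / real p) * (S * W)"
      using LS by (intro mult_left_mono) auto
    moreover have "(ln (real p) / real p) * W * 1 \<le> (ln (real p) / real p) * W * (1 + 1 / real p)"
      using W0 p by (intro mult_left_mono) auto
    ultimately show ?thesis by (simp add: algebra_simps)
  qed
  also have "\<dots> = (S + ln (real p) / real p) * ((1 + 1 / real p) * W)"
    by (simp add: algebra_simps)
  finally show ?case
    using insert.hyps by (simp add: S_def W_def add.commute)
qed

text \<open>Comparison with a telescoping sum: ln t \<le> t - 1 at t = n / (n + 1) gives 1 / (n + 1)
  \<le> ln (n + 1) - ln n.\<close>

lemma harmonic_sum_le: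
  assumes "n \<ge> 1"
  shows "(\<Sum>d=1..n. 1 / real d) \<le> 1 + ln (real n)"
  using assms
proof (induction n rule: nat_induct_at_least)
  case base
  then show ?case by simp
next
  case (Suc n)
  have "ln (real n / real (Suc n)) \<le> real n / real (Suc n) - 1"
    using Suc by (intro ln_le_minus_one) auto
  also have "\<dots> = - 1 / real (Suc n)" by (simp add: field_simps)
  finally have "1 / real (Suc n) \<le> ln (real (Suc n)) - ln (real n)"
    using Suc by (simp add: ln_div)
  with Suc show ?case by (simp del: of_nat_Suc)
qed

text \<open>Unique factorization: X is recovered as the set of primes dividing its product. Infinite
  sets are excluded because their \<open>Prod\<close> is 1 by convention, as it is for the empty
  set.\<close>

lemma inj_on_prod_primes: "inj_on Prod (Pow {p::nat. prime p} \<inter> {X. finite X})"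
proof (rule inj_onI)
  fix X Y :: "nat set"
  assume "X \<in> Pow {p. prime p} \<inter> {X. finite X}" "Y \<in> Pow {p. prime p} \<inter> {X. finite X}" "\<Prod>X = \<Prod>Y"
  moreover have "X = {p. prime p \<and> p dvd \<Prod>X}" if "X \<in> Pow {p. prime p} \<inter> {X. finite X}" for X :: "nat set"
    using that by (auto simp: prime_dvd_prod_iff) (metis Ball_Collect primes_dvd_imp_eq)
  ultimately show "X = Y" by metis
qed

text \<open>
  Expand the product into the squarefree numbers \<open>d\<close> built from \<open>P\<close>, each with weight \<open>1/d\<close>. The
  weighted mean of \<open>ln d\<close> is at most \<open>S = (\<Sum>p\<in>P. ln p / p)\<close>, so by Markov's inequality at least
  half of the weight lies on \<open>d \<le> exp (2 S + 1)\<close>, where the harmonic sum bounds it.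
\<close>
lemma prod_one_plus_inverse_primes_le:
  fixes P :: "nat set"
  assumes fin: "finite P" and pr: "\<And>p. p \<in> P \<Longrightarrow> prime p"
  shows "(\<Prod>p\<in>P. 1 + 1 / real p) \<le> 4 * (1 + (\<Sum>p\<in>P. ln (real p) / real p))"
proof -
  define W where "W = (\<Prod>p\<in>P. 1 + 1 / real p)"
  define S where "S = (\<Sum>p\<in>P. ln (real p) / real p)"
  define t where "t = 2 * S + 1"
  define A where "A = {X \<in> Pow P. ln (real (\<Prod>X)) \<le> t}"
  define N where "N = nat \<lfloor>exp t\<rfloor>"
  have "0 \<notin> P" using pr by force
  have S0: "S \<ge> 0" unfolding S_def using pr
    by (intro sum_nonneg divide_nonneg_nonneg ln_ge_zero) (auto dest: prime_gt_0_nat simp: Suc_le_eq)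
  have pos: "\<Prod>X \<ge> 1" if "X \<in> Pow P" for X
  proof -
    have "finite X" "0 \<notin> X" using that fin \<open>0 \<notin> P\<close> finite_subset by auto
    then show ?thesis by (simp add: Suc_le_eq prod_pos_nat_iff) (metis gr0I)
  qed
  have finA: "finite (Pow P)" "A \<subseteq> Pow P" using fin by (auto simp: A_def)
  have "t * (\<Sum>X\<in>Pow P - A. 1 / real (\<Prod>X)) = (\<Sum>X\<in>Pow P - A. t / real (\<Prod>X))"
    by (simp add: sum_distrib_left del: of_nat_prod)
  also have "\<dots> \<le> (\<Sum>X\<in>Pow P - A. ln (real (\<Prod>X)) / real (\<Prod>X))"
    by (intro sum_mono divide_right_mono) (auto simp: A_def simp del: of_nat_prod)
  also have "\<dots> \<le> (\<Sum>X\<in>Pow P. ln (real (\<Prod>X)) / real (\<Prod>X))"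
    using finA pos by (intro sum_mono2 divide_nonneg_nonneg ln_ge_zero) (auto simp del: of_nat_prod)
  also have "\<dots> \<le> S * W"
    unfolding S_def W_def by (rule sum_Pow_ln_prod_le[OF fin \<open>0 \<notin> P\<close>])
  finally have *: "t * (\<Sum>X\<in>Pow P - A. 1 / real (\<Prod>X)) \<le> S * W" .
  have "(\<Sum>X\<in>A. 1 / real (\<Prod>X)) = (\<Sum>d\<in>Prod ` A. 1 / real d)"
  proof (subst sum.reindex)
    show "inj_on Prod A"
      by (rule inj_on_subset[OF inj_on_prod_primes]) (use fin pr finite_subset in \<open>auto simp: A_def\<close>)
  qed (simp add: o_def)
  also have "\<dots> \<le> (\<Sum>d=1..N. 1 / real d)"
  proof (intro sum_mono2)
    show "Prod ` A \<subseteq> {1..N}"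
    proof (clarsimp simp del: of_nat_prod One_nat_def, intro conjI)
      fix X assume X: "X \<in> A"
      then have "1 \<le> \<Prod>X" "ln (real (\<Prod>X)) \<le> t" using pos finA by (auto simp: A_def simp del: of_nat_prod)
      then have "exp (ln (real (\<Prod>X))) \<le> exp t" "real (\<Prod>X) > 0"
        by (simp_all del: of_nat_prod exp_ln exp_ln_iff)
      then have "real (\<Prod>X) \<le> exp t" by (simp del: of_nat_prod)
      then show "\<Prod>X \<le> N" unfolding N_def by (simp add: le_nat_floor del: of_nat_prod)
      show "1 \<le> \<Prod>X" by fact
    qed
  qed auto
  also have "\<dots> \<le> 1 + ln (real N)"
    by (rule harmonic_sum_le) (use S0 in \<open>simp add: N_def t_def le_nat_floor\<close>)
  also have "ln (real N) \<le> t"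
  proof -
    have "N \<ge> 1" using S0 by (simp add: N_def t_def le_nat_floor)
    moreover have "real N \<le> exp t" by (simp add: N_def)
    ultimately show ?thesis using ln_mono[of "real N" "exp t"] by simp
  qed
  finally have **: "(\<Sum>X\<in>A. 1 / real (\<Prod>X)) \<le> 1 + t" by simp
  have "W = (\<Sum>X\<in>Pow P - A. 1 / real (\<Prod>X)) + (\<Sum>X\<in>A. 1 / real (\<Prod>X))"
    unfolding W_def sum_Pow_inverse_prod[OF fin, symmetric] by (rule sum.subset_diff) (use finA in auto)
  with ** have "t * W \<le> t * (\<Sum>X\<in>Pow P - A. 1 / real (\<Prod>X)) + t * (1 + t)"
    using S0 by (simp add: t_def distrib_left[symmetric] mult_left_mono)
  \<comment> \<open>The choice of t makes both sides divisible by S + 1: on the left t - S = S + 1,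
    on the right t (1 + t) = 2 (2 S + 1) (S + 1).\<close>
  with * have "(2 * S + 1 - S) * W \<le> t * (1 + t)" by (simp add: t_def algebra_simps)
  also have "\<dots> \<le> 4 * (1 + S) * (S + 1)" using S0 by (simp add: t_def algebra_simps)
  finally have "(S + 1) * W \<le> (S + 1) * (4 * (1 + S))" by (simp add: algebra_simps)
  then show ?thesis using S0 unfolding W_def S_def by simp
qed

text \<open>The product over all of 2..N telescopes to (N + 1) / (2 N), which exceeds 1 / 2.
  Discarding the factors outside P, which lie between 0 and 1, can only increase it.\<close>

lemma prod_one_minus_inverse_square_ge:
  fixes P :: "nat set"
  assumes "finite P" "\<And>p. p \<in> P \<Longrightarrow> p \<ge> 2"
  shows "1 / 2 \<le> (\<Prod>p\<in>P. 1 - 1 / (real p)\<^sup>2)"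
proof -
  obtain m where m: "P \<subseteq> {..m}" using assms(1) finite_nat_set_iff_bounded_le by auto
  \<comment> \<open>The successor ensures N \<ge> 1, so the closed form already holds for the empty
    product at N = 1.\<close>
  define N where "N = Suc m"
  have r: "(\<Prod>n=2..N. 1 - 1 / (real n)\<^sup>2) = (real N + 1) / (2 * real N)"
    unfolding N_def
  proof (induction m)
    case (Suc m)
    have "(\<Prod>n=2..Suc (Suc m). 1 - 1 / (real n)\<^sup>2) = (1 - 1 / (real (Suc (Suc m)))\<^sup>2) * ((real (Suc m) + 1) / (2 * real (Suc m)))"
      by (subst prod.cl_ivl_Suc) (use Suc in auto)
    also have "\<dots> = (real (Suc (Suc m)) + 1) / (2 * real (Suc (Suc m)))"
      by (simp add: divide_simps power2_eq_square) (simp add: algebra_simps)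
    finally show ?case .
  qed auto
  have "1 / 2 \<le> (\<Prod>n=2..N. 1 - 1 / (real n)\<^sup>2)" unfolding r by (simp add: N_def field_simps)
  also have "\<dots> = (\<Prod>n\<in>{2..N} - P. 1 - 1 / (real n)\<^sup>2) * (\<Prod>n\<in>P. 1 - 1 / (real n)\<^sup>2)"
    by (rule prod.subset_diff) (use m assms in \<open>auto simp: N_def\<close>)
  also have "\<dots> \<le> 1 * (\<Prod>n\<in>P. 1 - 1 / (real n)\<^sup>2)"
    by (intro mult_right_mono prod_le_1 prod_nonneg) (use assms(2) in \<open>force simp: field_simps\<close>)+
  finally show ?thesis by simp
qed

text \<open>Since 1 + 1 / p = (1 - 1 / p^2) / (1 - 1 / p), and the product of the numerators is at
  least 1 / 2, the bound for the product of 1 + 1 / p carries over with its constant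
  doubled.\<close>

lemma prod_inverse_one_minus_inverse_primes_le:
  fixes P :: "nat set"
  assumes fin: "finite P" and pr: "\<And>p. p \<in> P \<Longrightarrow> prime p"
  shows "(\<Prod>p\<in>P. 1 / (1 - 1 / real p)) \<le> 8 * (1 + (\<Sum>p\<in>P. ln (real p) / real p))"
proof -
  define Q where "Q = (\<Prod>p\<in>P. 1 / (1 - 1 / real p))"
  have p2: "real p \<ge> 2" if "p \<in> P" for p using pr[OF that] prime_ge_2_nat by force
  have Q0: "Q \<ge> 0" unfolding Q_def by (intro prod_nonneg) (auto dest!: p2)
  have "(\<Prod>p\<in>P. 1 + 1 / real p) = (\<Prod>p\<in>P. 1 / (1 - 1 / real p) * (1 - 1 / (real p)\<^sup>2))"
  proof (rule prod.cong[OF refl])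
    fix p assume "p \<in> P"
    then show "1 + 1 / real p = 1 / (1 - 1 / real p) * (1 - 1 / (real p)\<^sup>2)"
      using p2 by (simp add: divide_simps power2_eq_square) (force simp: algebra_simps)
  qed
  also have "\<dots> = Q * (\<Prod>p\<in>P. 1 - 1 / (real p)\<^sup>2)"
    unfolding Q_def by (rule prod.distrib)
  also have "\<dots> \<ge> Q * (1 / 2)"
    by (intro mult_left_mono prod_one_minus_inverse_square_ge Q0 fin) (use p2 in auto)
  finally show ?thesis
    using prod_one_plus_inverse_primes_le[OF fin pr] by (simp add: Q_def)
qed

section \<open>A Mertens-type bound from prime powers dividing a factorial\<close>

text \<open>Powers of distinct primes are coprime. The exponent may depend on p so that the lemma
  serves both for \<open>p ^ (n div p)\<close> in a factorial and for the squarefree divisors of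
  r.\<close>

lemma prod_prime_power_dvd:
  fixes n :: nat
  assumes "finite P" "\<And>p. p \<in> P \<Longrightarrow> prime p" "\<And>p. p \<in> P \<Longrightarrow> p ^ e p dvd n"
  shows "(\<Prod>p\<in>P. p ^ e p) dvd n"
  using assms
proof (induction P rule: finite_induct)
  case (insert p P)
  have "coprime (p ^ e p) (\<Prod>p\<in>P. p ^ e p)"
  proof (rule prod_coprime_right)
    fix q assume "q \<in> P"
    then have "coprime p q" using insert by (intro primes_coprime) auto
    then show "coprime (p ^ e p) (q ^ e q)" by simp
  qed
  with insert show ?case by (simp add: divides_mult)
qed auto

text \<open>Each of the \<open>n div p\<close> full blocks of p consecutive integers in 1..n ends in
  a multiple of p, which contributes one factor p.\<close>

lemma power_div_dvd_fact:
  fixes p n :: nat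
  assumes "p > 0"
  shows "p ^ (n div p) dvd fact n"
proof -
  have "p ^ k dvd fact (p * k)" for k
  proof (induction k)
    case (Suc k)
    have "p * Suc k = Suc (p * Suc k - 1)" using assms by simp
    then have "fact (p * Suc k) = p * Suc k * (fact (p * Suc k - 1) :: nat)"
      by (metis fact_Suc of_nat_id)
    moreover have "(fact (p * k) :: nat) dvd fact (p * Suc k - 1)"
      by (rule fact_dvd) (use assms in auto)
    moreover have "p * p ^ k dvd p * Suc k * fact (p * Suc k - 1)"
      by (rule mult_dvd_mono[OF dvd_triv_left dvd_trans[OF Suc]]) fact
    ultimately show ?case by simp
  qed auto
  also have "fact (p * (n div p)) dvd (fact n :: nat)"
    by (rule fact_dvd) (simp add: mult.commute)
  finally show ?thesis .
qed

text \<open>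
  Since \<open>p ^ (n div p)\<close> divides \<open>fact n\<close> and \<open>n div p \<ge> n / (2 p)\<close>, this follows from \<open>fact n \<le> n ^ n\<close>.
\<close>
lemma sum_ln_prime_over_prime_le:
  assumes "n \<ge> 1"
  shows "(\<Sum>p | prime p \<and> p \<le> n. ln (real p) / real p) \<le> 2 * ln (real n)"
proof -
  define P where "P = {p. prime p \<and> p \<le> n}"
  have fin: "finite P" by (auto simp: P_def)
  have p2: "p \<ge> 2" if "p \<in> P" for p using that prime_ge_2_nat by (auto simp: P_def)
  have "(\<Prod>p\<in>P. p ^ (n div p)) \<le> fact n"
    by (intro dvd_imp_le prod_prime_power_dvd fin power_div_dvd_fact) (auto simp: P_def prime_gt_0_nat)
  also have "(fact n :: nat) \<le> n ^ n" using fact_le_power[of n, where 'a = nat] by simp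
  finally have "real (\<Prod>p\<in>P. p ^ (n div p)) \<le> real (n ^ n)" by (rule of_nat_mono)
  moreover have "(\<Prod>p\<in>P. p ^ (n div p)) > 0" using p2 by (intro prod_pos) (auto dest!: p2)
  ultimately have "ln (real (\<Prod>p\<in>P. p ^ (n div p))) \<le> ln (real (n ^ n))"
    by (intro ln_mono) (auto simp del: of_nat_prod)
  then have "(\<Sum>p\<in>P. real (n div p) * ln (real p)) \<le> n * ln (real n)"
    using p2 fin assms by (subst (asm) of_nat_prod, subst (asm) ln_prod) (force simp: ln_realpow)+
  moreover have "(\<Sum>p\<in>P. real n / 2 * (ln (real p) / real p)) \<le> (\<Sum>p\<in>P. real (n div p) * ln (real p))"
  proof (rule sum_mono)
    fix p assume p: "p \<in> P"
    have "n div p \<ge> 1" using p p2 by (auto simp: P_def div_greater_zero_iff Suc_le_eq prime_gt_0_nat)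
    moreover have "n < p * (n div p) + p"
      using p2[OF p] mult_div_mod_eq[of p n] mod_less_divisor[of p n] by linarith
    moreover have "p * 1 \<le> p * (n div p)" by (rule mult_left_mono) (use calculation in auto)
    ultimately have "n \<le> 2 * (p * (n div p))" by linarith
    then have "real n \<le> 2 * (real p * real (n div p))" by (metis of_nat_le_iff of_nat_mult of_nat_numeral)
    then have "real n / 2 / real p \<le> real (n div p)" using p2[OF p] by (simp add: field_simps)
    then have "real n / 2 / real p * ln (real p) \<le> real (n div p) * ln (real p)"
      by (rule mult_right_mono) (use p2[OF p] in auto)
    then show "real n / 2 * (ln (real p) / real p) \<le> real (n div p) * ln (real p)" by simp
  qed
  ultimately have "real n / 2 * (\<Sum>p\<in>P. ln (real p) / real p) \<le> n * ln (real n)"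
    by (simp add: sum_distrib_left)
  then show ?thesis using assms by (simp add: P_def)
qed

section \<open>The ratio of r to its totient\<close>

text \<open>
  The primes between \<open>(ln x) powr \<alpha>\<close> and \<open>ln x\<close> satisfy \<open>ln p \<ge> \<alpha> ln (ln x)\<close>, so the previous bound
  applies to them; at most \<open>log 2 x\<close> primes above \<open>ln x\<close> divide \<open>r\<close>, each contributing at most \<open>1 / ln x\<close>.
\<close>
lemma sum_inverse_large_prime_factors_le:
  fixes x \<alpha> :: real
  assumes \<alpha>: "\<alpha> > 0" and r: "r > 0" "real r \<le> x" and x: "x \<ge> 2"
  shows "(\<Sum>p\<in>{p\<in>prime_factors r. (ln x) powr \<alpha> < real p}. 1 / real p) \<le> 2 / \<alpha> + 2"
proof -
  define z where "z = ln x"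
  define F where "F = {p\<in>prime_factors r. z powr \<alpha> < real p}"
  have z0: "z > 0" using x by (simp add: z_def)
  have finF: "finite F" by (simp add: F_def)
  have F_prime: "prime p" if "p \<in> F" for p using that by (auto simp: F_def)
  have F_ge_2: "real p \<ge> 2" if "p \<in> F" for p
    using prime_ge_2_nat[OF F_prime[OF that]] by simp
  have small: "(\<Sum>p\<in>{p\<in>F. real p \<le> z}. 1 / real p) \<le> 2 / \<alpha>"
  proof (cases "z < 2")
    \<comment> \<open>No prime is below 2, so the sum is empty. In the other case ln z > 0, which
      makes the division by \<open>\<alpha> * ln z\<close> legitimate.\<close>
    case True
    then have none: "{p\<in>F. real p \<le> z} = {}" by (auto dest!: F_ge_2)
    show ?thesis unfolding none using \<alpha> by simp
  next
    case False
    define n where "n = nat \<lfloor>z\<rfloor>"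
    have n: "n \<ge> 1" "real n \<le> z" using False by (auto simp: n_def le_nat_floor)
    have lz: "ln z > 0" using False by simp
    have "(\<Sum>p\<in>{p\<in>F. real p \<le> z}. 1 / real p)
        \<le> (\<Sum>p\<in>{p\<in>F. real p \<le> z}. (ln (real p) / real p) / (\<alpha> * ln z))"
    proof (rule sum_mono)
      fix p assume "p \<in> {p\<in>F. real p \<le> z}"
      then have p: "z powr \<alpha> < real p" "p > 0" using F_ge_2[of p] by (auto simp: F_def)
      have "ln (z powr \<alpha>) \<le> ln (real p)" using p z0 by (intro ln_mono) auto
      then have "\<alpha> * ln z \<le> ln (real p)" using z0 by (simp add: ln_powr)
      then show "1 / real p \<le> (ln (real p) / real p) / (\<alpha> * ln z)"
        using p lz \<alpha> by (simp add: field_simps)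
    qed
    also have "\<dots> \<le> (\<Sum>p | prime p \<and> p \<le> n. (ln (real p) / real p) / (\<alpha> * ln z))"
    proof (rule sum_mono2)
      show "{p\<in>F. real p \<le> z} \<subseteq> {p. prime p \<and> p \<le> n}"
        using F_prime by (auto simp: n_def le_nat_floor)
      show "0 \<le> ln (real p) / real p / (\<alpha> * ln z)" if "p \<in> {p. prime p \<and> p \<le> n} - {p\<in>F. real p \<le> z}" for p
        using that lz \<alpha> prime_gt_0_nat[of p] by (intro divide_nonneg_nonneg ln_ge_zero) auto
    qed auto
    also have "\<dots> = (\<Sum>p | prime p \<and> p \<le> n. ln (real p) / real p) / (\<alpha> * ln z)"
      by (simp add: sum_divide_distrib)
    also have "\<dots> \<le> (2 * ln z) / (\<alpha> * ln z)"
    proof (rule divide_right_mono)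
      have "ln (real n) \<le> ln z" using n by (intro ln_mono) auto
      then show "(\<Sum>p | prime p \<and> p \<le> n. ln (real p) / real p) \<le> 2 * ln z"
        using sum_ln_prime_over_prime_le[OF n(1)] by linarith
    qed (use lz \<alpha> in auto)
    also have "\<dots> = 2 / \<alpha>" using lz by simp
    finally show ?thesis .
  qed
  have large: "(\<Sum>p\<in>{p\<in>F. \<not> real p \<le> z}. 1 / real p) \<le> 2"
  proof -
    define G where "G = {p\<in>F. \<not> real p \<le> z}"
    have "2 ^ card G = (\<Prod>p\<in>G. 2::nat)" by simp
    also have "\<dots> \<le> (\<Prod>p\<in>G. p)"
      by (rule prod_mono) (auto simp: G_def dest!: F_ge_2)
    also have "\<dots> = (\<Prod>p\<in>G. p ^ 1)" by simp
    also have "\<dots> \<le> r"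
      by (intro dvd_imp_le prod_prime_power_dvd r) (auto simp: G_def F_def)
    finally have "real (2 ^ card G) \<le> real r" by (rule of_nat_mono)
    from order_trans[OF this r(2)] have "2 ^ card G \<le> x" by simp
    then have "ln (2 ^ card G) \<le> z" unfolding z_def by (intro ln_mono) auto
    then have "real (card G) * ln 2 \<le> z" by (simp add: ln_realpow)
    \<comment> \<open>The crude bound ln 2 \<ge> 1 / 2 replaces z / ln 2 by 2 z and so gives the
      constant 2.\<close>
    moreover have "1 / 2 \<le> ln (2::real)" using ln_one_minus_pos_upper_bound[of "1/2::real"] by (simp add: ln_div)
    then have "real (card G) * (1 / 2) \<le> real (card G) * ln 2" by (intro mult_left_mono) auto
    ultimately have card: "real (card G) \<le> 2 * z" by simp
    have "(\<Sum>p\<in>G. 1 / real p) \<le> (\<Sum>p\<in>G. 1 / z)"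
      by (intro sum_mono divide_left_mono) (use z0 in \<open>auto simp: G_def\<close>)
    also have "\<dots> \<le> 2" using card z0 by (simp add: field_simps)
    finally show ?thesis by (simp add: G_def)
  qed
  have "(\<Sum>p\<in>F. 1 / real p) = (\<Sum>p\<in>{p\<in>F. real p \<le> z}. 1 / real p) + (\<Sum>p\<in>{p\<in>F. \<not> real p \<le> z}. 1 / real p)"
    using finF by (subst sum.union_disjoint[symmetric]) (auto intro!: sum.cong)
  with small large show ?thesis by (simp add: F_def z_def)
qed

text \<open>After clearing the denominator, 1 / (1 - t) \<le> 1 + 2 t says 2 t^2 \<le> t, which is
  where t \<le> 1 / 2 enters.\<close>

lemma inverse_one_minus_le_exp:
  fixes t :: real
  assumes "0 \<le> t" "t \<le> 1 / 2"
  shows "1 / (1 - t) \<le> exp (2 * t)"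
proof -
  have "2 * (t * t) \<le> t" using assms mult_left_mono[of t "1/2" t] by simp
  then have "1 / (1 - t) \<le> 1 + 2 * t" using assms by (simp add: divide_simps algebra_simps)
  also have "\<dots> \<le> exp (2 * t)" by (rule exp_ge_add_one_self)
  finally show ?thesis .
qed

text \<open>The ratio is the product of 1 / (1 - 1 / p) over the primes dividing r. Those above
  \<open>(ln x) powr \<alpha>\<close> contribute at most the exponential of twice their reciprocal
  sum, hence a constant depending on \<alpha>; the small ones give the sum of ln p / p.\<close>

lemma over_totient_le:
  fixes x \<alpha> :: real
  assumes \<alpha>: "\<alpha> > 0" and r: "r > 0" "real r \<le> x" and x: "x \<ge> 2"
  shows "real r / real (totient r) \<le> 8 * exp (4 / \<alpha> + 4) *
    (1 + (\<Sum>p | prime p \<and> real p \<le> (ln x) powr \<alpha> \<and> p dvd r. ln (real p) / real p))"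
proof -
  define y where "y = (ln x) powr \<alpha>"
  define A where "A = {p\<in>prime_factors r. real p \<le> y}"
  define B where "B = {p\<in>prime_factors r. y < real p}"
  have p2: "real p \<ge> 2" if "p \<in> prime_factors r" for p
    using that prime_ge_2_nat[of p] by force
  have factor_nonneg: "0 \<le> 1 / (1 - 1 / real p)" if "p \<in> prime_factors r" for p
    using p2[OF that] by simp
  have "(\<Prod>p\<in>B. 1 / (1 - 1 / real p)) \<le> (\<Prod>p\<in>B. exp (2 * (1 / real p)))"
  proof (intro prod_mono conjI inverse_one_minus_le_exp)
    fix p assume "p \<in> B"
    then have "p \<in> prime_factors r" by (simp add: B_def)
    then show "0 \<le> 1 / (1 - 1 / real p)" "1 / real p \<le> 1 / 2"
      using p2[of p] by (auto intro: factor_nonneg)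
  qed auto
  also have "\<dots> = exp (2 * (\<Sum>p\<in>B. 1 / real p))"
    by (simp add: exp_sum B_def sum_distrib_left)
  also have "\<dots> \<le> exp (4 / \<alpha> + 4)"
    using sum_inverse_large_prime_factors_le[OF assms] by (simp add: B_def y_def)
  finally have B_le: "(\<Prod>p\<in>B. 1 / (1 - 1 / real p)) \<le> exp (4 / \<alpha> + 4)" .
  have A_le: "(\<Prod>p\<in>A. 1 / (1 - 1 / real p)) \<le> 8 * (1 + (\<Sum>p\<in>A. ln (real p) / real p))"
    by (rule prod_inverse_one_minus_inverse_primes_le) (auto simp: A_def)
  have nonneg: "0 \<le> (\<Prod>p\<in>A. 1 / (1 - 1 / real p))" "0 \<le> (\<Prod>p\<in>B. 1 / (1 - 1 / real p))"
    unfolding A_def B_def by (rule prod_nonneg; rule factor_nonneg; simp)+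
  have "real r / real (totient r) = (\<Prod>p\<in>prime_factors r. 1 / (1 - 1 / real p))"
    using r by (simp add: totient_formula2 prod_dividef)
  also have "\<dots> = (\<Prod>p\<in>A. 1 / (1 - 1 / real p)) * (\<Prod>p\<in>B. 1 / (1 - 1 / real p))"
    by (subst prod.union_disjoint[symmetric]) (auto simp: A_def B_def intro!: prod.cong)
  also have "\<dots> \<le> 8 * (1 + (\<Sum>p\<in>A. ln (real p) / real p)) * exp (4 / \<alpha> + 4)"
    using A_le B_le nonneg by (intro mult_mono) auto
  also have "A = {p. prime p \<and> real p \<le> y \<and> p dvd r}"
    using r by (auto simp: A_def prime_factors_dvd)
  finally show ?thesis by (simp only: y_def mult_ac)
qed

section \<open>Finiteness of the counts and the second moment method\<close>

lemma finite_indices_le: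
  fixes c :: "nat \<Rightarrow> nat" and x :: real
  assumes "\<And>n. c n > 0" "\<And>v. v > 0 \<Longrightarrow> finite {j. c j = v}"
  shows "finite {j. real (c j) \<le> x}"
proof (rule finite_subset)
  show "{j. real (c j) \<le> x} \<subseteq> (\<Union>v\<in>{1..nat \<lfloor>x\<rfloor>}. {j. c j = v})"
    using assms(1) by (auto simp: le_nat_floor Suc_le_eq)
  show "finite (\<Union>v\<in>{1..nat \<lfloor>x\<rfloor>}. {j. c j = v})"
    using assms(2) by auto
qed

text \<open>Points with f below T contribute at most M, so at least M of the total 2 M comes from
  the remaining set, to which Cauchy-Schwarz is applied.\<close>

lemma second_moment_bound:
  fixes f :: "'a \<Rightarrow> real"
  assumes fin: "finite N" and T: "0 \<le> T" "real (card N) * T \<le> M" and M: "0 \<le> M" "2 * M \<le> sum f N"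
    and Q: "(\<Sum>n\<in>N. (f n)\<^sup>2) \<le> Q"
  shows "M\<^sup>2 \<le> real (card {n\<in>N. T \<le> f n}) * Q"
proof -
  define G where "G = {n\<in>N. T \<le> f n}"
  have G: "G \<subseteq> N" by (auto simp: G_def)
  have "sum f (N - G) \<le> real (card (N - G)) * T"
    by (rule sum_bounded_above) (auto simp: G_def)
  also have "\<dots> \<le> real (card N) * T"
    using fin T by (intro mult_right_mono) (auto intro: card_mono)
  finally have "sum f (N - G) \<le> M" using T by linarith
  moreover have "sum f N = sum f (N - G) + sum f G"
    by (rule sum.subset_diff[OF G fin])
  ultimately have "M \<le> sum f G" using M by linarith
  then have "M\<^sup>2 \<le> (sum f G)\<^sup>2" using M by (intro power_mono)
  also have "\<dots> \<le> (\<Sum>n\<in>G. (f n)\<^sup>2) * card G" by (rule sum_squared_le_sum_of_squares)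
  also have "\<dots> \<le> Q * card G"
    using Q sum_mono2[OF fin G, of "\<lambda>n. (f n)\<^sup>2"] by (intro mult_right_mono) auto
  finally show ?thesis by (simp add: G_def mult.commute)
qed

section \<open>Counting additive quadruples\<close>

lemma sum_card_sum_eq:
  fixes a :: "'i \<Rightarrow> nat" and b :: "'j \<Rightarrow> nat"
  assumes "finite I" "finite J" "finite N" "\<And>i j. i \<in> I \<Longrightarrow> j \<in> J \<Longrightarrow> a i + b j \<in> N"
  shows "(\<Sum>n\<in>N. card {(i, j) \<in> I \<times> J. a i + b j = n}) = card I * card J"
proof -
  have "(\<Sum>n\<in>N. \<Sum>u\<in>{u \<in> I \<times> J. (case u of (i, j) \<Rightarrow> a i + b j) = n}. 1::nat) = (\<Sum>u\<in>I \<times> J. 1)"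
    by (rule sum.group) (use assms in auto)
  moreover have "{u \<in> I \<times> J. (case u of (i, j) \<Rightarrow> a i + b j) = n} = {(i, j) \<in> I \<times> J. a i + b j = n}" for n
    by auto
  ultimately show ?thesis by (simp add: card_cartesian_product)
qed

text \<open>A square counts pairs of representations of the same n. Regrouping these quadruples by
  their two b-indices leaves, for each pair, a problem about differences of values of a
  alone.\<close>

lemma sum_square_card_sum_eq:
  fixes a :: "'i \<Rightarrow> nat" and b :: "'j \<Rightarrow> nat"
  assumes fin: "finite I" "finite J" "finite N" and sub: "\<And>i j. i \<in> I \<Longrightarrow> j \<in> J \<Longrightarrow> a i + b j \<in> N"
  shows "(\<Sum>n\<in>N. (card {(i, j) \<in> I \<times> J. a i + b j = n})\<^sup>2)
       = (\<Sum>j\<in>J. \<Sum>j'\<in>J. card {(i, i') \<in> I \<times> I. a i + b j = a i' + b j'})"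
proof -
  define S where "S n = {(i, j) \<in> I \<times> J. a i + b j = n}" for n
  define E where "E q = {(i, i') \<in> I \<times> I. a i + b (fst q) = a i' + b (snd q)}" for q
  have finS: "finite (S n)" for n
    by (rule finite_subset[of _ "I \<times> J"]) (use fin in \<open>auto simp: S_def\<close>)
  have finE: "finite (E q)" for q
    by (rule finite_subset[of _ "I \<times> I"]) (use fin in \<open>auto simp: E_def\<close>)
  have "(\<Sum>n\<in>N. (card (S n))\<^sup>2) = (\<Sum>n\<in>N. card (S n \<times> S n))"
    by (simp add: power2_eq_square card_cartesian_product)
  also have "\<dots> = card (\<Union>n\<in>N. S n \<times> S n)"
    by (rule card_UN_disjoint[symmetric]) (use fin finS in \<open>auto simp: S_def\<close>)
  also have "\<dots> = card (Sigma (J \<times> J) E)"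
    by (rule bij_betw_same_card[of "\<lambda>((i, j), (i', j')). ((j, j'), (i, i'))"],
        rule bij_betw_byWitness[where f' = "\<lambda>((j, j'), (i, i')). ((i, j), (i', j'))"])
      (use sub in \<open>auto simp: S_def E_def\<close>)
  also have "\<dots> = (\<Sum>q\<in>J \<times> J. card (E q))"
    by (rule card_SigmaI) (use fin finE in auto)
  also have "\<dots> = (\<Sum>j\<in>J. \<Sum>j'\<in>J. card (E (j, j')))"
    by (simp add: sum.cartesian_product)
  finally show ?thesis by (simp add: S_def E_def)
qed

lemma card_eq_sum_pairs_diag:
  fixes a :: "'i \<Rightarrow> nat"
  assumes "inj a" "finite I"
  shows "card {(i, i') \<in> I \<times> I. a i + u = a i' + u} = card I"
  by (rule bij_betw_same_card[of fst], rule bij_betw_byWitness[where f' = "\<lambda>i. (i, i)"])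
     (use assms in \<open>auto dest: injD\<close>)

text \<open>By injectivity of a, the index i' determines i, and a i' + (v - u) = a i is a value of
  a; hence the projection to the second component.\<close>

lemma card_eq_sum_pairs_le:
  fixes a :: "'i \<Rightarrow> nat"
  assumes "inj a" "finite I" "u < v"
  shows "card {(i, i') \<in> I \<times> I. a i + u = a i' + v} \<le> card {i \<in> I. a i + (v - u) \<in> range a}"
proof (rule card_inj_on_le[of snd])
  show "inj_on snd {(i, i') \<in> I \<times> I. a i + u = a i' + v}"
  proof (rule inj_onI, clarsimp)
    fix i j i' assume "a i + u = a i' + v" "a j + u = a i' + v"
    then have "a i = a j" by linarith
    then show "i = j" using assms(1) by (rule injD[rotated])
  qed
  show "snd ` {(i, i') \<in> I \<times> I. a i + u = a i' + v} \<subseteq> {i \<in> I. a i + (v - u) \<in> range a}"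
  proof clarsimp
    fix i i' assume "a i + u = a i' + v"
    then have "a i' + (v - u) = a i" using assms(3) by linarith
    then show "a i' + (v - u) \<in> range a" by simp
  qed
qed (use assms in simp)

lemma card_eq_sum_pairs_swap:
  "card {(i, i') \<in> I \<times> I. a i + u = a i' + v} = card {(i, i') \<in> I \<times> I. a i + v = a i' + (u::nat)}"
  by (rule bij_betw_same_card[of prod.swap], rule bij_betw_byWitness[where f' = prod.swap]) auto

text \<open>The shift hypothesis is applied with r = v - u. Divisibility of v - u by p is rewritten
  as a congruence, with an \<open>if\<close> in the summand instead of a restricted range, so that
  the sum over p can later be interchanged with a sum over indices.\<close>

lemma card_eq_sum_pairs_totient_le:
  fixes a :: "nat \<Rightarrow> nat" and x C :: real
  assumes inj: "inj a" and fin: "finite {i. real (a i) \<le> x}"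
    and I: "I \<subseteq> {i. real (a i) \<le> x}"
    and shift: "\<And>r. r > 0 \<Longrightarrow> real (count_shift a x r) \<le> C * (real r / real (totient r))"
    and x: "x \<ge> 2" and \<alpha>: "\<alpha> > 0" and C: "C \<ge> 0" and uv: "u < v" "real v \<le> x"
  shows "real (card {(i, i') \<in> I \<times> I. a i + u = a i' + v}) \<le> C * (8 * exp (4 / \<alpha> + 4)) *
    (1 + (\<Sum>p | prime p \<and> real p \<le> (ln x) powr \<alpha>. if [u = v] (mod p) then ln (real p) / real p else 0))"
proof -
  have finI: "finite I" using I fin by (rule finite_subset)
  have "card {(i, i') \<in> I \<times> I. a i + u = a i' + v} \<le> card {i \<in> I. a i + (v - u) \<in> range a}"
    by (rule card_eq_sum_pairs_le[OF inj finI uv(1)])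
  also have "\<dots> \<le> count_shift a x (v - u)"
    unfolding count_shift_def using I fin by (intro card_mono) auto
  finally have "real (card {(i, i') \<in> I \<times> I. a i + u = a i' + v}) \<le> real (count_shift a x (v - u))"
    by (rule of_nat_mono)
  also have "\<dots> \<le> C * (real (v - u) / real (totient (v - u)))"
    using uv by (intro shift) auto
  also have "\<dots> \<le> C * (8 * exp (4 / \<alpha> + 4) *
    (1 + (\<Sum>p | prime p \<and> real p \<le> (ln x) powr \<alpha> \<and> p dvd v - u. ln (real p) / real p)))"
    using uv by (intro mult_left_mono over_totient_le \<alpha> x C) auto
  also have "(\<Sum>p | prime p \<and> real p \<le> (ln x) powr \<alpha> \<and> p dvd v - u. ln (real p) / real p)
     = (\<Sum>p | prime p \<and> real p \<le> (ln x) powr \<alpha>. if [u = v] (mod p) then ln (real p) / real p else 0)"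
  proof (rule sum.mono_neutral_cong_left)
    show "finite {p. prime p \<and> real p \<le> (ln x) powr \<alpha>}"
      by (rule finite_subset[of _ "{..nat \<lfloor>(ln x) powr \<alpha>\<rfloor>}"]) (auto simp: le_nat_floor)
  qed (use uv in \<open>auto simp: cong_altdef_nat cong_sym_eq[of u v]\<close>)
  finally show ?thesis by (simp add: mult.assoc)
qed

section \<open>The second moment of the representation count\<close>

lemma sum_rep_square_le:
  fixes a b :: "nat \<Rightarrow> nat" and x C :: real
  assumes inj: "inj a" and finA: "finite {i. real (a i) \<le> x}"
    and I: "I \<subseteq> {i. real (a i) \<le> x}"
    and b: "\<And>n. b n > 0" and finB: "finite {j. real (b j) \<le> x}" and J: "J \<subseteq> {j. real (b j) \<le> x}"
    and shift: "\<And>r. r > 0 \<Longrightarrow> real (count_shift a x r) \<le> C * (real r / real (totient r))"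
    and cong: "(\<Sum>j\<in>{j. real (b j) \<le> x}. \<Sum>p\<in>{p::nat. prime p \<and> real p \<le> (ln x) powr \<alpha>}.
               real (lambda_cong b x j p) * ln (real p) / real p) \<le> K * (real (count_le b x))\<^sup>2"
    and x: "x \<ge> 2" and \<alpha>: "\<alpha> > 0" and C: "C \<ge> 0"
  shows "(\<Sum>j\<in>J. \<Sum>j'\<in>J. real (card {(i, i') \<in> I \<times> I. a i + b j = a i' + b j'}))
     \<le> real (card I) * real (count_le b x) * real (rho b x)
       + C * (8 * exp (4 / \<alpha> + 4)) * (1 + K) * (real (count_le b x))\<^sup>2"
proof -
  define B where "B = {j. real (b j) \<le> x}"
  define P where "P = {p::nat. prime p \<and> real p \<le> (ln x) powr \<alpha>}"
  define D where "D = C * (8 * exp (4 / \<alpha> + 4))"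
  define g where "g j j' = 1 + (\<Sum>p\<in>P. if [b j' = b j] (mod p) then ln (real p) / real p else 0)" for j j'
  have finI: "finite I" using I finA by (rule finite_subset)
  have D0: "D \<ge> 0" using C by (simp add: D_def)
  have lnp: "ln (real p) / real p \<ge> 0" if "p \<in> P" for p
    using that prime_gt_0_nat[of p] by (intro divide_nonneg_nonneg ln_ge_zero) (auto simp: P_def)
  have g0: "g j j' \<ge> 0" for j j'
    unfolding g_def by (intro add_nonneg_nonneg sum_nonneg) (auto intro: lnp)
  \<comment> \<open>One majorant for all pairs: the first term covers equal values of b, the second
    unequal ones in either order.\<close>
  have pair: "real (card {(i, i') \<in> I \<times> I. a i + b j = a i' + b j'})
     \<le> (if b j' = b j then real (card I) else 0) + D * g j j'" if "j \<in> B" "j' \<in> B" for j j'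
  proof (cases "b j" "b j'" rule: linorder_cases)
    case equal
    then show ?thesis using card_eq_sum_pairs_diag[OF inj finI, of "b j'"] D0 g0[of j j'] by simp
  next
    case less
    then show ?thesis
      using card_eq_sum_pairs_totient_le[OF inj finA I shift x \<alpha> C less] that
      by (simp add: D_def g_def P_def B_def cong_sym_eq[of "b j"])
  next
    case greater
    then show ?thesis
      using card_eq_sum_pairs_totient_le[OF inj finA I shift x \<alpha> C greater] that
      by (subst card_eq_sum_pairs_swap) (simp add: D_def g_def P_def B_def)
  qed
  have diag: "(\<Sum>j\<in>B. \<Sum>j'\<in>B. if b j' = b j then real (card I) else 0)
      \<le> real (card I) * real (card B) * real (rho b x)"
  proof -
    have "(\<Sum>j'\<in>B. if b j' = b j then real (card I) else 0) \<le> real (card I) * real (rho b x)" if "j \<in> B" for j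
    proof -
      have "finite {v. 1 \<le> v \<and> real v \<le> x}"
        by (rule finite_subset[of _ "{..nat \<lfloor>x\<rfloor>}"]) (auto simp: le_nat_floor)
      moreover have "b j \<in> {v. 1 \<le> v \<and> real v \<le> x}"
        using that b[of j] by (auto simp: B_def)
      ultimately have "ord_seq b (b j) \<le> rho b x"
        unfolding rho_def by (intro Max_ge) auto
      \<comment> \<open>Since b j \<le> x, every index with the same value lies in B, so the
        restricted count is the full \<open>ord_seq\<close>.\<close>
      moreover have "{j'\<in>B. b j' = b j} = {j'. b j' = b j}"
        using that by (auto simp: B_def)
      ultimately have "card {j'\<in>B. b j' = b j} \<le> rho b x" by (simp add: ord_seq_def)
      moreover have "(\<Sum>j'\<in>B. if b j' = b j then real (card I) else 0)
          = (\<Sum>j'\<in>{j'\<in>B. b j' = b j}. real (card I))"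
        using finB by (intro sum.inter_filter[symmetric]) (simp add: B_def)
      ultimately show ?thesis by (simp add: mult.commute mult_left_mono)
    qed
    then have "(\<Sum>j\<in>B. \<Sum>j'\<in>B. if b j' = b j then real (card I) else 0)
        \<le> (\<Sum>j\<in>B. real (card I) * real (rho b x))" by (rule sum_mono)
    then show ?thesis by (simp add: mult_ac)
  qed
  \<comment> \<open>Interchanging the sums over j' and p turns the congruence indicators into
    \<open>lambda_cong\<close>.\<close>
  have g_sum: "(\<Sum>j'\<in>B. g j j')
      = real (card B) + (\<Sum>p\<in>P. real (lambda_cong b x j p) * ln (real p) / real p)" for j
  proof -
    have "(\<Sum>j'\<in>B. if [b j' = b j] (mod p) then ln (real p) / real p else 0)
       = real (lambda_cong b x j p) * ln (real p) / real p" for p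
    proof -
      have "(\<Sum>j'\<in>B. if [b j' = b j] (mod p) then ln (real p) / real p else 0)
         = (\<Sum>j'\<in>{j'\<in>B. [b j' = b j] (mod p)}. ln (real p) / real p)"
        using finB by (intro sum.inter_filter[symmetric]) (simp add: B_def)
      then show ?thesis by (simp add: lambda_cong_def B_def)
    qed
    then show ?thesis
      unfolding g_def sum.distrib by (subst sum.swap) simp
  qed
  have off: "(\<Sum>j\<in>B. \<Sum>j'\<in>B. D * g j j') \<le> D * (1 + K) * (real (card B))\<^sup>2"
  proof -
    have "(\<Sum>j\<in>B. \<Sum>j'\<in>B. g j j') \<le> (1 + K) * (real (card B))\<^sup>2"
      using cong unfolding g_sum sum.distrib
      by (simp add: B_def P_def count_le_def power2_eq_square algebra_simps)
    then have "D * (\<Sum>j\<in>B. \<Sum>j'\<in>B. g j j') \<le> D * ((1 + K) * (real (card B))\<^sup>2)"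
      using D0 by (rule mult_left_mono)
    then show ?thesis by (simp add: sum_distrib_left mult.assoc)
  qed
  \<comment> \<open>The terms are nonnegative, so J may be enlarged to B, the range over which the
    congruence hypothesis is stated.\<close>
  have "(\<Sum>j\<in>J. \<Sum>j'\<in>J. real (card {(i, i') \<in> I \<times> I. a i + b j = a i' + b j'}))
     \<le> (\<Sum>j\<in>J. \<Sum>j'\<in>B. real (card {(i, i') \<in> I \<times> I. a i + b j = a i' + b j'}))"
    using finB J by (intro sum_mono sum_mono2) (auto simp: B_def)
  also have "\<dots> \<le> (\<Sum>j\<in>B. \<Sum>j'\<in>B. real (card {(i, i') \<in> I \<times> I. a i + b j = a i' + b j'}))"
    using finB J by (intro sum_mono2 sum_nonneg) (auto simp: B_def)
  also have "\<dots> \<le> (\<Sum>j\<in>B. \<Sum>j'\<in>B. (if b j' = b j then real (card I) else 0) + D * g j j')"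
    by (intro sum_mono pair)
  also have "\<dots> \<le> real (card I) * real (card B) * real (rho b x) + D * (1 + K) * (real (card B))\<^sup>2"
    unfolding sum.distrib by (intro add_mono diag off)
  finally show ?thesis by (simp add: D_def B_def count_le_def)
qed

section \<open>The lower bound at a fixed x\<close>

text \<open>The growth, shift and congruence hypotheses are used at a single x, so \<eta> enters
  only through the number h standing for its value there. The constants are explicit, which shows
  that they depend on \<alpha> and the K's only.\<close>

lemma card_rep_count_ge:
  fixes a b :: "nat \<Rightarrow> nat" and x h \<alpha> K1 K2 K3 K4 K5 K6 :: real
  assumes pos: "\<alpha> > 0" "K1 > 0" "K2 > 0" "K3 > 0" "K4 > 0" "K5 > 0" "K6 > 0" and h: "h > 0" and x: "x \<ge> 2"
    and a: "\<And>n. a n > 0" "strict_mono a"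
    and b: "\<And>n. b n > 0" "\<And>v. v > 0 \<Longrightarrow> finite {j. b j = v}"
    and A: "K1 * (x / h) \<le> real (count_le a x)" "real (count_le a x) \<le> K2 * (x / h)"
      "K3 * real (count_le a x) \<le> real (count_le a (x / 2))"
    and shift: "\<And>r. r > 0 \<Longrightarrow> real (count_shift a x r) \<le> K4 * (real r / real (totient r)) * (x / h\<^sup>2)"
    and B: "K5 * real (count_le b x) \<le> real (count_le b (x / 2))"
    and cong: "(\<Sum>j\<in>{j. real (b j) \<le> x}. \<Sum>p\<in>{p::nat. prime p \<and> real p \<le> (ln x) powr \<alpha>}.
               real (lambda_cong b x j p) * ln (real p) / real p) \<le> K6 * (real (count_le b x))\<^sup>2"
  defines "c1 \<equiv> K1 * K3 * K5 / 2"
  shows "c1\<^sup>2 / (K2 + K4 * (8 * exp (4 / \<alpha> + 4)) * (1 + K6)) * x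
      * (real (count_le b x) / (real (count_le b x) + real (rho b x) * h))
    \<le> real (card {n::nat. 1 \<le> n \<and> real n \<le> x \<and> c1 * (real (count_le b x) / h) \<le> real (rep_count a b n)})"
proof -
  define \<beta> where "\<beta> = real (count_le b x)"
  define \<rho> where "\<rho> = real (rho b x)"
  define D where "D = 8 * exp (4 / \<alpha> + 4)"
  \<comment> \<open>C dominates both the diagonal constant K2 and the off-diagonal one, so that the
    second moment bound factors as Q.\<close>
  define C where "C = K2 + K4 * D * (1 + K6)"
  \<comment> \<open>Cutting both sequences at x / 2 keeps all sums a i + b j at most x.\<close>
  define I where "I = {i. real (a i) \<le> x / 2}"
  define J where "J = {j. real (b j) \<le> x / 2}"
  define N where "N = {n::nat. 1 \<le> n \<and> real n \<le> x}"
  define R where "R n = card {(i, j) \<in> I \<times> J. a i + b j = n}" for n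
  have inj: "inj a" using a(2) by (rule strict_mono_imp_inj_on)
  have finite_a: "finite {i. real (a i) \<le> y}" for y
  proof (rule finite_indices_le[OF a(1)])
    show "finite {j. a j = v}" for v
      using finite_vimageI[OF _ inj, of "{v}"] by (simp add: vimage_def)
  qed
  have finite_b: "finite {j. real (b j) \<le> y}" for y
    by (rule finite_indices_le[OF b])
  have sub: "I \<subseteq> {i. real (a i) \<le> x}" "J \<subseteq> {j. real (b j) \<le> x}"
    using x by (auto simp: I_def J_def)
  have fin: "finite I" "finite J" unfolding I_def J_def by (rule finite_a, rule finite_b)
  have N: "N \<subseteq> {1..nat \<lfloor>x\<rfloor>}" by (auto simp: N_def le_nat_floor)
  then have finN: "finite N" by (rule finite_subset) simp
  have "card N \<le> nat \<lfloor>x\<rfloor>" using card_mono[OF _ N] by simp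
  then have cardN: "real (card N) \<le> x" using x by (simp add: le_nat_iff le_floor_iff)
  have IJN: "a i + b j \<in> N" if "i \<in> I" "j \<in> J" for i j
    using that a(1)[of i] by (auto simp: I_def J_def N_def)
  have D0: "D > 0" by (simp add: D_def)
  have C0: "C > 0" using pos D0 by (simp add: C_def add_pos_pos)
  have c0: "c1 > 0" using pos by (simp add: c1_def)
  have \<beta>0: "\<beta> \<ge> 0" and \<rho>0: "\<rho> \<ge> 0" by (auto simp: \<beta>_def \<rho>_def)
  \<comment> \<open>M is half of the lower bound for the first moment; this is the origin of the 2
    in the denominator of c1.\<close>
  define M where "M = c1 * x * \<beta> / h"
  define Q where "Q = C * (x * \<beta> / h\<^sup>2) * (\<beta> + \<rho> * h)"
  have first: "2 * M \<le> (\<Sum>n\<in>N. real (R n))"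
  proof -
    have "K3 * (K1 * (x / h)) \<le> real (card I)"
      using mult_left_mono[OF A(1), of K3] A(3) pos(4) by (simp add: count_le_def I_def)
    moreover have "K5 * \<beta> \<le> real (card J)" using B by (simp add: count_le_def J_def \<beta>_def)
    ultimately have "(K3 * (K1 * (x / h))) * (K5 * \<beta>) \<le> real (card I) * real (card J)"
      using pos \<beta>0 by (intro mult_mono) auto
    moreover have "(\<Sum>n\<in>N. real (R n)) = real (card I) * real (card J)"
      using sum_card_sum_eq[OF fin finN IJN] by (simp add: R_def flip: of_nat_sum of_nat_mult)
    moreover have "2 * M = (K3 * (K1 * (x / h))) * (K5 * \<beta>)" by (simp add: M_def c1_def)
    ultimately show ?thesis by simp
  qed
  have second: "(\<Sum>n\<in>N. (real (R n))\<^sup>2) \<le> Q"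
  proof -
    have "(\<Sum>n\<in>N. (real (R n))\<^sup>2)
        = (\<Sum>j\<in>J. \<Sum>j'\<in>J. real (card {(i, i') \<in> I \<times> I. a i + b j = a i' + b j'}))"
      using arg_cong[OF sum_square_card_sum_eq[OF fin finN IJN], where f = real] by (simp add: R_def)
    also have "\<dots> \<le> real (card I) * \<beta> * \<rho> + K4 * (x / h\<^sup>2) * D * (1 + K6) * \<beta>\<^sup>2"
      unfolding D_def \<beta>_def \<rho>_def
      by (rule sum_rep_square_le[OF inj finite_a sub(1) b(1) finite_b sub(2) _ cong x pos(1)])
        (use shift pos x in \<open>simp_all add: mult_ac\<close>)
    also have "real (card I) \<le> K2 * (x / h)"
      using A(2) card_mono[OF finite_a sub(1)] by (simp add: count_le_def)
    also have "K2 * (x / h) * \<beta> * \<rho> + K4 * (x / h\<^sup>2) * D * (1 + K6) * \<beta>\<^sup>2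
        = x * \<beta> / h\<^sup>2 * (K2 * (\<rho> * h) + K4 * D * (1 + K6) * \<beta>)"
      using h by (simp add: field_simps power2_eq_square)
    also have "\<dots> \<le> x * \<beta> / h\<^sup>2 * (C * (\<rho> * h) + C * \<beta>)"
    proof (intro mult_left_mono add_mono mult_right_mono)
      show "K2 \<le> C" "K4 * D * (1 + K6) \<le> C" using pos D0 by (auto simp: C_def)
    qed (use x \<beta>0 \<rho>0 h in auto)
    also have "\<dots> = Q" by (simp add: Q_def algebra_simps)
    finally show ?thesis using \<beta>0 \<rho>0 by (simp add: mult_right_mono)
  qed
  have rep: "R n \<le> rep_count a b n" for n
    unfolding R_def rep_count_def
  proof (rule card_mono)
    show "finite {(i, j). a i + b j = n}"
      by (rule finite_subset[OF _ finite_cartesian_product[OF finite_a[of "real n"] finite_b[of "real n"]]]) auto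
  qed auto
  \<comment> \<open>With this threshold x T = M, so the n with R n < T account for at most M of the
    first moment.\<close>
  define T where "T = c1 * (\<beta> / h)"
  define G where "G = {n::nat. 1 \<le> n \<and> real n \<le> x \<and> T \<le> real (rep_count a b n)}"
  have "M\<^sup>2 \<le> real (card {n\<in>N. T \<le> real (R n)}) * Q"
  proof (rule second_moment_bound[OF finN _ _ _ first second])
    have "real (card N) * T \<le> x * T"
      using cardN c0 \<beta>0 h by (intro mult_right_mono) (auto simp: T_def)
    then show "real (card N) * T \<le> M" by (simp add: T_def M_def mult_ac)
  qed (use c0 \<beta>0 h x in \<open>auto simp: T_def M_def\<close>)
  also have "\<dots> \<le> real (card G) * Q"
  proof (intro mult_right_mono of_nat_mono card_mono)
    show "finite G" by (rule finite_subset[OF _ finN]) (auto simp: G_def N_def)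
    show "{n\<in>N. T \<le> real (R n)} \<subseteq> G"
      using rep by (auto simp: G_def N_def intro: order_trans)
    show "0 \<le> Q" using C0 x \<beta>0 \<rho>0 h by (simp add: Q_def)
  qed
  finally have main: "M\<^sup>2 \<le> real (card G) * Q" .
  have "c1\<^sup>2 / C * x * (\<beta> / (\<beta> + \<rho> * h)) \<le> real (card G)"
  \<comment> \<open>For \<beta> = 0 the left side vanishes. Otherwise Q > 0, and the claimed bound
    times Q is exactly \<open>M\<^sup>2\<close>, so Q cancels from \<open>main\<close>.\<close>
  proof (cases "\<beta> = 0")
    case False
    then have \<beta>: "\<beta> > 0" using \<beta>0 by simp
    define w where "w = \<beta> + \<rho> * h"
    have w: "w > 0" using \<beta> \<rho>0 h by (simp add: w_def add_pos_nonneg)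
    have Q0: "Q > 0" using C0 x \<beta> w h by (simp add: Q_def w_def)
    have "c1\<^sup>2 / C * x * (\<beta> / w) * Q = M\<^sup>2"
      using C0 w h by (simp add: Q_def M_def flip: w_def) (simp add: field_simps power2_eq_square)
    with main have "c1\<^sup>2 / C * x * (\<beta> / w) * Q \<le> real (card G) * Q" by simp
    then show ?thesis using Q0 unfolding w_def by (rule mult_right_le_imp_le)
  qed simp
  then show ?thesis by (simp add: C_def D_def \<beta>_def \<rho>_def G_def T_def)
qed

theorem theorem1p1:
  fixes \<alpha> K1 K2 K3 K4 K5 K6 :: real
  assumes "0 < \<alpha>" and "\<alpha> < 1"
    and "K1 > 0" and "K2 > 0" and "K3 > 0" and "K4 > 0" and "K5 > 0" and "K6 > 0"
  shows "\<exists>c1>0. \<exists>c2>0. \<forall>(\<eta> :: real \<Rightarrow> real) (a :: nat \<Rightarrow> nat) (b :: nat \<Rightarrow> nat).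
    (\<forall>x\<ge>2. \<eta> x > 0) \<longrightarrow>
    (\<forall>n. a n > 0) \<longrightarrow> strict_mono a \<longrightarrow>
    (\<forall>n. b n > 0) \<longrightarrow> (\<forall>v>0. finite {j. b j = v}) \<longrightarrow>
    (\<forall>x\<ge>2. K1 * (x / \<eta> x) \<le> real (count_le a x) \<and>
            real (count_le a x) \<le> K2 * (x / \<eta> x) \<and>
            real (count_le a (x / 2)) \<ge> K3 * real (count_le a x)) \<longrightarrow>
    (\<forall>x\<ge>2. \<forall>r::nat. r > 0 \<longrightarrow>
            real (count_shift a x r) \<le> K4 * (real r / real (totient r)) * (x / (\<eta> x)\<^sup>2)) \<longrightarrow>
    (\<forall>x\<ge>2. real (count_le b (x / 2)) \<ge> K5 * real (count_le b x)) \<longrightarrow>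
    (\<forall>x\<ge>2. (\<Sum>j\<in>{j. real (b j) \<le> x}. \<Sum>p\<in>{p::nat. prime p \<and> real p \<le> (ln x) powr \<alpha>}.
               real (lambda_cong b x j p) * ln (real p) / real p)
            \<le> K6 * (real (count_le b x))\<^sup>2) \<longrightarrow>
    (\<forall>x\<ge>2.
       real (card {n::nat. 1 \<le> n \<and> real n \<le> x \<and>
                   real (rep_count a b n) \<ge> c1 * (real (count_le b x) / \<eta> x)})
       \<ge> c2 * x * (real (count_le b x) / (real (count_le b x) + real (rho b x) * \<eta> x)))"
proof (intro exI conjI allI impI)
  show "K1 * K3 * K5 / 2 > 0" using assms by simp
  show "(K1 * K3 * K5 / 2)\<^sup>2 / (K2 + K4 * (8 * exp (4 / \<alpha> + 4)) * (1 + K6)) > 0"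
    using assms by (simp add: add_pos_pos)
qed (rule card_rep_count_ge; use assms in blast)

end
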